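(* Let $n\ge 4$ be an integer and let $\mathcal{Q}(n)$ be the $n$-Queens' graph. Then: 1. $-4$ is an eigenvalue of $\mathcal{Q}(n)$ if and only if there exists a vector $X=(x_{(i,j)})_{(i,j)\in[n]^2}\in\mathbb{R}^{n^2}\setminus\{\mathbf{0}\}$ such that (a) $\sum_{j=1}^n x_{(k,j)}=0$ and $\sum_{i=1}^n x_{(i,k)}=0$ for every $k\in[n]$; (b) $\sum_{i+j=k+2} x_{(i,j)}=0$ for every $k\in[2n-3]$; (c) $\sum_{i-j=k+1-n} x_{(i,j)}=0$ for every $k\in[2n-3]$; (d) $x_{(1,1)}=x_{(1,n)}=x_{(n,1)}=x_{(n,n)}=0$, where the sums range over $(i,j)\in[n]^2$. In the positive case, any such $X$ is an eigenvector associated with the eigenvalue $-4$. 2. The least eigenvalue of $\mathcal{Q}(n)$ is $-4$.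
   Context: $[n]=\{1,\dots,n\}$. The $n$-Queens' graph $\mathcal{Q}(n)$ has vertex set $[n]^2$ (the squares of an $n\times n$ chessboard, $(i,j)$ being row $i$, column $j$), and two distinct vertices $(i,j),(i',j')$ are adjacent if and only if $i=i'$, or $j=j'$, or $i+j=i'+j'$, or $i-j=i'-j'$. Eigenvalues are those of the adjacency matrix. *)

theory Defs
  imports Complex_Main "Jordan_Normal_Form.Char_Poly"
begin

definition queens_vertices :: "nat \<Rightarrow> (nat \<times> nat) set" where
  "queens_vertices n = {1..n} \<times> {1..n}"

text \<open>The difference of coordinates is taken in the integers, since subtraction of natural
  numbers truncates.\<close>

definition queens_adj :: "nat \<Rightarrow> nat \<times> nat \<Rightarrow> nat \<times> nat \<Rightarrow> bool" where
  "queens_adj n u v \<longleftrightarrow>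
     u \<in> queens_vertices n \<and> v \<in> queens_vertices n \<and> u \<noteq> v \<and>
     (fst u = fst v \<or> snd u = snd v \<or> fst u + snd u = fst v + snd v \<or>
      int (fst u) - int (snd u) = int (fst v) - int (snd v))"

text \<open>Matrices and vectors of the library are indexed by \<open>0, 1, \<dots>\<close>, so an adjacency matrix, and
  the coordinate vector of a family of reals indexed by vertices, are taken with respect to a list
  of the vertices. The squares of the board are listed row by row.\<close>

definition adjacency_mat :: "'a list \<Rightarrow> ('a \<Rightarrow> 'a \<Rightarrow> bool) \<Rightarrow> real mat" where
  "adjacency_mat vs adj =
     mat (length vs) (length vs) (\<lambda>(p, q). if adj (vs ! p) (vs ! q) then 1 else 0)"

definition coord_vec :: "'a list \<Rightarrow> ('a \<Rightarrow> real) \<Rightarrow> real vec" where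
  "coord_vec vs X = vec (length vs) (\<lambda>p. X (vs ! p))"

definition queens_list :: "nat \<Rightarrow> (nat \<times> nat) list" where
  "queens_list n = List.product [1..<Suc n] [1..<Suc n]"

lemma set_queens_list: "set (queens_list n) = queens_vertices n"
  by (auto simp: queens_list_def queens_vertices_def)

lemma distinct_queens_list: "distinct (queens_list n)"
  unfolding queens_list_def by (intro distinct_product distinct_upt)

definition queens_mat :: "nat \<Rightarrow> real mat" where
  "queens_mat n = adjacency_mat (queens_list n) (queens_adj n)"

text \<open>A vector indexed by the squares is a function of which only the values on
  \<^term>\<open>queens_vertices n\<close> matter; in particular being nonzero refers to those values only.\<close>

definition queens_vec_nonzero :: "nat \<Rightarrow> (nat \<times> nat \<Rightarrow> real) \<Rightarrow> bool" where
  "queens_vec_nonzero n X \<longleftrightarrow> (\<exists>v \<in> queens_vertices n. X v \<noteq> 0)"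

definition queens_conditions :: "nat \<Rightarrow> (nat \<times> nat \<Rightarrow> real) \<Rightarrow> bool" where
  "queens_conditions n X \<longleftrightarrow>
     (\<forall>k \<in> {1..n}. (\<Sum>j = 1..n. X (k, j)) = 0 \<and> (\<Sum>i = 1..n. X (i, k)) = 0) \<and>
     (\<forall>k \<in> {1..2 * n - 3}. (\<Sum>(i, j) \<in> {(i, j) \<in> queens_vertices n. i + j = k + 2}. X (i, j)) = 0) \<and>
     (\<forall>k \<in> {1..2 * n - 3}.
        (\<Sum>(i, j) \<in> {(i, j) \<in> queens_vertices n. int i - int j = int k + 1 - int n}. X (i, j)) = 0) \<and>
     X (1, 1) = 0 \<and> X (1, n) = 0 \<and> X (n, 1) = 0 \<and> X (n, n) = 0"

end

(* Call the rows, the columns and all diagonals, corner squares included, the lines of the board.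
   Every square lies on four lines and two squares are adjacent iff they share exactly one line, so
   (A + 4 I) X evaluated at a square is the sum over its four lines of the line sums of X, and the
   quadratic form of A + 4 I is the sum of the squares of all line sums.  Hence every eigenvalue is
   at least -4, and its eigenspace consists of the vectors whose line sums all vanish.  A 4 x 4
   pattern in a corner of the board provides such a vector. *)
theory Submission
  imports Defs
begin

section \<open>Eigenvectors of an adjacency matrix as functions on the vertices\<close>

lemma coord_vec_surj:
  assumes "distinct vs" and "w \<in> carrier_vec (length vs)"
  shows "\<exists>X. w = coord_vec vs X"
proof
  \<comment> \<open>The index of \<open>v\<close> in \<open>vs\<close> is unique because
    \<open>vs\<close> is distinct. Off \<open>set vs\<close> the value is unspecified, but
    \<open>coord_vec\<close> never reads it.\<close>
  let ?X = "\<lambda>v. w $ (the_inv_into {..<length vs} ((!) vs) v)"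
  have "inj_on ((!) vs) {..<length vs}"
    using assms(1) by (simp add: inj_on_nth)
  then show "w = coord_vec vs ?X"
    using assms(2) by (intro eq_vecI) (auto simp: coord_vec_def the_inv_into_f_f)
qed

lemma sum_nth_distinct:
  assumes "distinct vs"
  shows "(\<Sum>q<length vs. g (vs ! q)) = (\<Sum>v\<in>set vs. g v)"
  using sum.reindex_bij_betw[OF bij_betw_nth[OF assms refl refl]] .

lemma adjacency_mat_mult_coord_vec:
  assumes "distinct vs"
  shows "adjacency_mat vs adj *\<^sub>v coord_vec vs X =
    coord_vec vs (\<lambda>u. \<Sum>v\<in>set vs. if adj u v then X v else 0)"
proof (intro eq_vecI)
  fix p assume "p < dim_vec (coord_vec vs (\<lambda>u. \<Sum>v\<in>set vs. if adj u v then X v else 0))"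
  then have p: "p < length vs" by (simp add: coord_vec_def)
  have "(adjacency_mat vs adj *\<^sub>v coord_vec vs X) $ p =
      (\<Sum>q<length vs. if adj (vs ! p) (vs ! q) then X (vs ! q) else 0)"
    using p by (auto simp: adjacency_mat_def coord_vec_def scalar_prod_def lessThan_atLeast0
        intro!: sum.cong)
  also have "\<dots> = (\<Sum>v\<in>set vs. if adj (vs ! p) v then X v else 0)"
    by (rule sum_nth_distinct[OF assms])
  finally show "(adjacency_mat vs adj *\<^sub>v coord_vec vs X) $ p =
      coord_vec vs (\<lambda>u. \<Sum>v\<in>set vs. if adj u v then X v else 0) $ p"
    using p by (simp add: coord_vec_def)
qed (simp add: adjacency_mat_def coord_vec_def)

lemma coord_vec_eq_iff: "coord_vec vs X = coord_vec vs Y \<longleftrightarrow> (\<forall>v\<in>set vs. X v = Y v)"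
  by (auto simp: coord_vec_def vec_eq_iff all_set_conv_all_nth)

lemma eigenvector_adjacency_mat_iff:
  assumes "distinct vs"
  shows "eigenvector (adjacency_mat vs adj) (coord_vec vs X) k \<longleftrightarrow>
    (\<exists>v\<in>set vs. X v \<noteq> 0) \<and>
    (\<forall>u\<in>set vs. (\<Sum>v\<in>set vs. if adj u v then X v else 0) = k * X u)"
proof -
  have "k \<cdot>\<^sub>v coord_vec vs X = coord_vec vs (\<lambda>v. k * X v)"
    "0\<^sub>v (length vs) = coord_vec vs (\<lambda>_. 0)"
    by (auto simp: coord_vec_def)
  moreover have "dim_row (adjacency_mat vs adj) = length vs"
    "coord_vec vs X \<in> carrier_vec (length vs)"
    by (simp_all add: adjacency_mat_def coord_vec_def)
  ultimately show ?thesis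
    unfolding eigenvector_def
    by (simp add: adjacency_mat_mult_coord_vec[OF assms] coord_vec_eq_iff)
qed

lemma eigenvalue_adjacency_mat_iff:
  assumes "distinct vs"
  shows "eigenvalue (adjacency_mat vs adj) k \<longleftrightarrow>
    (\<exists>X. eigenvector (adjacency_mat vs adj) (coord_vec vs X) k)"
proof
  assume "eigenvalue (adjacency_mat vs adj) k"
  then obtain w where w: "eigenvector (adjacency_mat vs adj) w k"
    by (auto simp: eigenvalue_def)
  then have "w \<in> carrier_vec (length vs)"
    by (simp add: eigenvector_def adjacency_mat_def)
  with w show "\<exists>X. eigenvector (adjacency_mat vs adj) (coord_vec vs X) k"
    using coord_vec_surj[OF assms] by blast
qed (auto simp: eigenvalue_def)

section \<open>Sums over the fibres of a map\<close>

text \<open>Each of the four families of lines consists of the fibres of one map on the squares, so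
  this single notion gives all the line sums. The type of \<open>c\<close> is left free because
  three of the maps take values in \<open>nat\<close> and the fourth in \<open>int\<close>.\<close>

definition fibre_sum :: "'a set \<Rightarrow> ('a \<Rightarrow> 'b) \<Rightarrow> ('a \<Rightarrow> real) \<Rightarrow> 'b \<Rightarrow> real" where
  "fibre_sum V f X c = (\<Sum>v\<in>{v \<in> V. f v = c}. X v)"

lemma fibre_sum_eq_sum_if:
  "finite V \<Longrightarrow> fibre_sum V f X c = (\<Sum>v\<in>V. if f v = c then X v else 0)"
  unfolding fibre_sum_def by (simp add: sum.inter_filter)

lemma fibre_sum_eq_0_iff:
  "(\<forall>c. fibre_sum V f X c = 0) \<longleftrightarrow> (\<forall>u\<in>V. fibre_sum V f X (f u) = 0)"
proof (intro iffI allI)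
  fix c assume *: "\<forall>u\<in>V. fibre_sum V f X (f u) = 0"
  show "fibre_sum V f X c = 0"
  proof (cases "c \<in> f ` V")
    case True
    with * show ?thesis by auto
  next
    case False
    then have "{v \<in> V. f v = c} = {}" by auto
    then show ?thesis by (simp only: fibre_sum_def sum.empty)
  qed
qed simp

text \<open>Group the points by their fibre: on a fibre the second factor is constant, and the first
  factors add up to the same constant.\<close>

lemma sum_mult_fibre_sum:
  assumes "finite V"
  shows "(\<Sum>u\<in>V. X u * fibre_sum V f X (f u)) = (\<Sum>c\<in>f ` V. (fibre_sum V f X c)\<^sup>2)"
proof -
  have "(\<Sum>u\<in>V. X u * fibre_sum V f X (f u)) =
      (\<Sum>c\<in>f ` V. \<Sum>u\<in>{u \<in> V. f u = c}. X u * fibre_sum V f X (f u))"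
    using assms by (rule sum.image_gen)
  also have "\<dots> = (\<Sum>c\<in>f ` V. \<Sum>u\<in>{u \<in> V. f u = c}. X u * fibre_sum V f X c)"
    by (intro sum.cong) auto
  also have "\<dots> = (\<Sum>c\<in>f ` V. (fibre_sum V f X c)\<^sup>2)"
    by (simp add: fibre_sum_def power2_eq_square sum_distrib_right)
  finally show ?thesis .
qed

lemma sum_mult_fibre_sum_nonneg:
  "finite V \<Longrightarrow> 0 \<le> (\<Sum>u\<in>V. X u * fibre_sum V f X (f u))"
  by (simp add: sum_mult_fibre_sum sum_nonneg)

lemma sum_mult_fibre_sum_eq_0:
  assumes "finite V" and "(\<Sum>u\<in>V. X u * fibre_sum V f X (f u)) = 0"
  shows "fibre_sum V f X c = 0"
proof -
  have "\<forall>c\<in>f ` V. (fibre_sum V f X c)\<^sup>2 = 0"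
    using assms by (simp add: sum_mult_fibre_sum sum_nonneg_eq_0_iff)
  then show ?thesis
    using fibre_sum_eq_0_iff[of V f X] by auto
qed

section \<open>The lines of the board and the quadratic form of A + 4 I\<close>

abbreviation antidiag :: "nat \<times> nat \<Rightarrow> nat" where
  "antidiag v \<equiv> fst v + snd v"

abbreviation diag :: "nat \<times> nat \<Rightarrow> int" where
  "diag v \<equiv> int (fst v) - int (snd v)"

lemma finite_queens_vertices [simp]: "finite (queens_vertices n)"
  by (simp add: queens_vertices_def)

text \<open>Any two of row, column, antidiagonal and diagonal determine a square, so a square other
  than \<open>u\<close> shares at most one line with \<open>u\<close> and is counted at most once on
  the right. The square \<open>u\<close> lies on all four lines and is counted four times, which
  accounts for \<open>4 * X u\<close>.\<close>

lemma queens_adj_sum: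
  assumes "u \<in> queens_vertices n"
  shows "(\<Sum>v\<in>queens_vertices n. if queens_adj n u v then X v else 0) + 4 * X u =
    fibre_sum (queens_vertices n) fst X (fst u) + fibre_sum (queens_vertices n) snd X (snd u) +
    fibre_sum (queens_vertices n) antidiag X (antidiag u) +
    fibre_sum (queens_vertices n) diag X (diag u)" (is "?S + _ = ?R")
proof -
  have "4 * X u = (\<Sum>v\<in>queens_vertices n. if v = u then 4 * X v else 0)"
    using assms by simp
  then have "?S + 4 * X u = (\<Sum>v\<in>queens_vertices n.
      (if queens_adj n u v then X v else 0) + (if v = u then 4 * X v else 0))"
    by (simp add: sum.distrib)
  also have "\<dots> = (\<Sum>v\<in>queens_vertices n.
      (if fst v = fst u then X v else 0) + (if snd v = snd u then X v else 0) +
      (if antidiag v = antidiag u then X v else 0) + (if diag v = diag u then X v else 0))"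
    using assms by (intro sum.cong) (auto simp: queens_adj_def prod_eq_iff)
  also have "\<dots> = ?R"
    by (simp add: fibre_sum_eq_sum_if sum.distrib)
  finally show ?thesis .
qed

definition line_sums_zero :: "nat \<Rightarrow> (nat \<times> nat \<Rightarrow> real) \<Rightarrow> bool" where
  "line_sums_zero n X \<longleftrightarrow>
    (\<forall>c. fibre_sum (queens_vertices n) fst X c = 0) \<and>
    (\<forall>c. fibre_sum (queens_vertices n) snd X c = 0) \<and>
    (\<forall>c. fibre_sum (queens_vertices n) antidiag X c = 0) \<and>
    (\<forall>c. fibre_sum (queens_vertices n) diag X c = 0)"

lemma queens_eigenvector_iff:
  "eigenvector (queens_mat n) (coord_vec (queens_list n) X) k \<longleftrightarrow> queens_vec_nonzero n X \<and>
    (\<forall>u\<in>queens_vertices n.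
      (\<Sum>v\<in>queens_vertices n. if queens_adj n u v then X v else 0) = k * X u)"
  by (simp add: queens_mat_def eigenvector_adjacency_mat_iff distinct_queens_list
      set_queens_list queens_vec_nonzero_def)

text \<open>Take the inner product of (A + 4 I) X = (k + 4) X with X, expanding the left side into
  line sums by \<open>queens_adj_sum\<close>.\<close>

lemma queens_eigenvector_quadratic_form:
  assumes "eigenvector (queens_mat n) (coord_vec (queens_list n) X) k"
  defines "V \<equiv> queens_vertices n"
  shows "(k + 4) * (\<Sum>u\<in>V. (X u)\<^sup>2) =
    (\<Sum>u\<in>V. X u * fibre_sum V fst X (fst u)) + (\<Sum>u\<in>V. X u * fibre_sum V snd X (snd u)) +
    (\<Sum>u\<in>V. X u * fibre_sum V antidiag X (antidiag u)) +
    (\<Sum>u\<in>V. X u * fibre_sum V diag X (diag u))"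
proof -
  have "(k + 4) * (\<Sum>u\<in>V. (X u)\<^sup>2) = (\<Sum>u\<in>V. X u * (k * X u + 4 * X u))"
    by (simp add: sum_distrib_left power2_eq_square algebra_simps)
  also have "\<dots> = (\<Sum>u\<in>V. X u * (fibre_sum V fst X (fst u) + fibre_sum V snd X (snd u) +
      fibre_sum V antidiag X (antidiag u) + fibre_sum V diag X (diag u)))"
  proof (intro sum.cong refl)
    fix u assume u: "u \<in> V"
    then have "k * X u + 4 * X u = fibre_sum V fst X (fst u) + fibre_sum V snd X (snd u) +
        fibre_sum V antidiag X (antidiag u) + fibre_sum V diag X (diag u)"
      using assms(1) queens_adj_sum[of u n X] by (simp add: queens_eigenvector_iff V_def)
    then show "X u * (k * X u + 4 * X u) = X u * (fibre_sum V fst X (fst u) +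
        fibre_sum V snd X (snd u) + fibre_sum V antidiag X (antidiag u) +
        fibre_sum V diag X (diag u))"
      by simp
  qed
  finally show ?thesis
    by (simp add: distrib_left sum.distrib)
qed

text \<open>The quadratic form is nonnegative, while the squared norm multiplying
  \<open>k + 4\<close> is positive.\<close>

lemma queens_eigenvector_ge:
  assumes "eigenvector (queens_mat n) (coord_vec (queens_list n) X) k"
  shows "- 4 \<le> k"
proof -
  let ?V = "queens_vertices n"
  obtain v where "v \<in> ?V" "X v \<noteq> 0"
    using assms by (auto simp: queens_eigenvector_iff queens_vec_nonzero_def)
  then have "0 < (\<Sum>u\<in>?V. (X u)\<^sup>2)"
    by (intro sum_pos2[of _ v]) auto
  moreover have "0 \<le> (k + 4) * (\<Sum>u\<in>?V. (X u)\<^sup>2)"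
    unfolding queens_eigenvector_quadratic_form[OF assms]
    by (intro add_nonneg_nonneg sum_mult_fibre_sum_nonneg finite_queens_vertices)
  ultimately show ?thesis
    by (simp add: zero_le_mult_iff)
qed

text \<open>For this eigenvalue the factor \<open>k + 4\<close> is zero, so four nonnegative terms
  add up to zero and each vanishes; being a sum of squared line sums, each forces its line sums to
  vanish. The converse is read off from \<open>queens_adj_sum\<close>.\<close>

lemma queens_eigenvector_minus_4_iff:
  "eigenvector (queens_mat n) (coord_vec (queens_list n) X) (- 4) \<longleftrightarrow>
    queens_vec_nonzero n X \<and> line_sums_zero n X"
proof
  let ?V = "queens_vertices n"
  assume ev: "eigenvector (queens_mat n) (coord_vec (queens_list n) X) (- 4)"
  note nonneg = sum_mult_fibre_sum_nonneg[OF finite_queens_vertices, of X n]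
  have "(\<Sum>u\<in>?V. X u * fibre_sum ?V fst X (fst u)) = 0"
    "(\<Sum>u\<in>?V. X u * fibre_sum ?V snd X (snd u)) = 0"
    "(\<Sum>u\<in>?V. X u * fibre_sum ?V antidiag X (antidiag u)) = 0"
    "(\<Sum>u\<in>?V. X u * fibre_sum ?V diag X (diag u)) = 0"
    using queens_eigenvector_quadratic_form[OF ev, unfolded add.left_inverse mult_zero_left]
      nonneg[of fst] nonneg[of snd] nonneg[of antidiag] nonneg[of diag]
    by linarith+
  then have "line_sums_zero n X"
    unfolding line_sums_zero_def
    by (intro conjI allI; intro sum_mult_fibre_sum_eq_0 finite_queens_vertices)
  with ev show "queens_vec_nonzero n X \<and> line_sums_zero n X"
    by (simp add: queens_eigenvector_iff)
next
  assume *: "queens_vec_nonzero n X \<and> line_sums_zero n X"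
  have "(\<Sum>v\<in>queens_vertices n. if queens_adj n u v then X v else 0) = - 4 * X u"
    if "u \<in> queens_vertices n" for u
    using queens_adj_sum[OF that, of X] * by (simp add: line_sums_zero_def)
  with * show "eigenvector (queens_mat n) (coord_vec (queens_list n) X) (- 4)"
    by (simp add: queens_eigenvector_iff)
qed

section \<open>The conditions of the theorem as vanishing line sums\<close>

lemma fibre_sum_fst:
  assumes "k \<in> {1..n}"
  shows "fibre_sum (queens_vertices n) fst X k = (\<Sum>j = 1..n. X (k, j))"
proof -
  have "{v \<in> queens_vertices n. fst v = k} = Pair k ` {1..n}"
    using assms by (auto simp: queens_vertices_def)
  then show ?thesis
    by (simp add: fibre_sum_def sum.reindex inj_on_def)
qed

lemma fibre_sum_snd:
  assumes "k \<in> {1..n}"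
  shows "fibre_sum (queens_vertices n) snd X k = (\<Sum>i = 1..n. X (i, k))"
proof -
  have "{v \<in> queens_vertices n. snd v = k} = (\<lambda>i. (i, k)) ` {1..n}"
    using assms by (auto simp: queens_vertices_def)
  then show ?thesis
    by (simp add: fibre_sum_def sum.reindex inj_on_def)
qed

lemma queens_conditions_iff_fibre_sum:
  "queens_conditions n X \<longleftrightarrow>
    (\<forall>k\<in>{1..n}. fibre_sum (queens_vertices n) fst X k = 0 \<and>
      fibre_sum (queens_vertices n) snd X k = 0) \<and>
    (\<forall>k\<in>{1..2 * n - 3}. fibre_sum (queens_vertices n) antidiag X (k + 2) = 0) \<and>
    (\<forall>k\<in>{1..2 * n - 3}. fibre_sum (queens_vertices n) diag X (int k + 1 - int n) = 0) \<and>
    X (1, 1) = 0 \<and> X (1, n) = 0 \<and> X (n, 1) = 0 \<and> X (n, n) = 0"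
proof -
  have "(\<Sum>(i, j)\<in>{(i, j) \<in> queens_vertices n. i + j = k + 2}. X (i, j)) =
      fibre_sum (queens_vertices n) antidiag X (k + 2)" for k
    by (auto simp: fibre_sum_def intro!: sum.cong)
  moreover have "(\<Sum>(i, j)\<in>{(i, j) \<in> queens_vertices n. int i - int j = int k + 1 - int n}.
      X (i, j)) = fibre_sum (queens_vertices n) diag X (int k + 1 - int n)" for k
    by (auto simp: fibre_sum_def intro!: sum.cong)
  ultimately show ?thesis
    by (simp add: queens_conditions_def fibre_sum_fst fibre_sum_snd)
qed

text \<open>These four diagonals are single corner squares, so condition (d) is the vanishing of
  their line sums.\<close>

lemma fibre_sum_corner:
  assumes "n \<ge> 1"
  shows "fibre_sum (queens_vertices n) antidiag X 2 = X (1, 1)"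
    and "fibre_sum (queens_vertices n) antidiag X (2 * n) = X (n, n)"
    and "fibre_sum (queens_vertices n) diag X (1 - int n) = X (1, n)"
    and "fibre_sum (queens_vertices n) diag X (int n - 1) = X (n, 1)"
proof -
  have "{v \<in> queens_vertices n. antidiag v = 2} = {(1, 1)}"
    "{v \<in> queens_vertices n. antidiag v = 2 * n} = {(n, n)}"
    "{v \<in> queens_vertices n. diag v = 1 - int n} = {(1, n)}"
    "{v \<in> queens_vertices n. diag v = int n - 1} = {(n, 1)}"
    using assms by (auto simp: queens_vertices_def)
  then show "fibre_sum (queens_vertices n) antidiag X 2 = X (1, 1)"
    "fibre_sum (queens_vertices n) antidiag X (2 * n) = X (n, n)"
    "fibre_sum (queens_vertices n) diag X (1 - int n) = X (1, n)"
    "fibre_sum (queens_vertices n) diag X (int n - 1) = X (n, 1)"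
    by (simp_all add: fibre_sum_def)
qed

text \<open>In (b) the value \<open>k + 2\<close> runs from 3 to 2n - 1, and in (c) the value k + 1
  - n runs from 2 - n to n - 2. The only diagonals left out are those of the corners, which (d)
  covers.\<close>

lemma queens_conditions_iff_line_sums_zero:
  assumes "n \<ge> 1"
  shows "queens_conditions n X \<longleftrightarrow> line_sums_zero n X"
proof
  let ?V = "queens_vertices n"
  assume "queens_conditions n X"
  then have rows: "\<And>k. k \<in> {1..n} \<Longrightarrow> fibre_sum ?V fst X k = 0"
    and cols: "\<And>k. k \<in> {1..n} \<Longrightarrow> fibre_sum ?V snd X k = 0"
    and antidiags: "\<And>k. k \<in> {1..2 * n - 3} \<Longrightarrow> fibre_sum ?V antidiag X (k + 2) = 0"
    and diags: "\<And>k. k \<in> {1..2 * n - 3} \<Longrightarrow> fibre_sum ?V diag X (int k + 1 - int n) = 0"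
    and corners: "X (1, 1) = 0" "X (1, n) = 0" "X (n, 1) = 0" "X (n, n) = 0"
    by (simp_all add: queens_conditions_iff_fibre_sum)
  have "fibre_sum ?V antidiag X (antidiag u) = 0" if u: "u \<in> ?V" for u
  proof -
    \<comment> \<open>The second equation of the third case records that the subtraction of naturals
      does not truncate.\<close>
    consider "antidiag u = 2" | "antidiag u = 2 * n"
      | "antidiag u - 2 \<in> {1..2 * n - 3}" "antidiag u = (antidiag u - 2) + 2"
      using u by (fastforce simp: queens_vertices_def)
    then show ?thesis
    proof cases
      case 3
      then show ?thesis using antidiags[of "antidiag u - 2"] by metis
    qed (simp_all only: fibre_sum_corner[OF assms] corners)
  qed
  moreover have "fibre_sum ?V diag X (diag u) = 0" if u: "u \<in> ?V" for u
  proof -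
    \<comment> \<open>Obtained by solving \<open>diag u = int k + 1 - int n\<close>. Since
      \<open>diag u\<close> is at least 1 - n on the board, \<open>nat\<close> loses
      nothing.\<close>
    define k where "k = nat (diag u + int n - 1)"
    consider "diag u = 1 - int n" | "diag u = int n - 1"
      | "k \<in> {1..2 * n - 3}" "diag u = int k + 1 - int n"
      using u by (fastforce simp: queens_vertices_def k_def)
    then show ?thesis
    proof cases
      case 3
      then show ?thesis using diags[of k] by metis
    qed (simp_all only: fibre_sum_corner[OF assms] corners)
  qed
  moreover have "fibre_sum ?V fst X (fst u) = 0" "fibre_sum ?V snd X (snd u) = 0"
    if "u \<in> ?V" for u
    using that rows cols by (auto simp: queens_vertices_def)
  ultimately show "line_sums_zero n X"
    by (simp add: line_sums_zero_def fibre_sum_eq_0_iff)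
next
  assume "line_sums_zero n X"
  then show "queens_conditions n X"
    unfolding queens_conditions_iff_fibre_sum line_sums_zero_def
    using fibre_sum_corner[OF assms, of X] by simp
qed

section \<open>A nonzero vector with vanishing line sums\<close>

text \<open>The pattern, with rows and columns numbered from 1, is
  0 + - 0 / - 0 0 + / + 0 0 - / 0 - + 0.\<close>

lemma ex_line_sums_zero:
  assumes "n \<ge> 4"
  shows "\<exists>X. queens_vec_nonzero n X \<and> line_sums_zero n X"
proof -
  define P N :: "(nat \<times> nat) set"
    where "P = {(1, 2), (2, 4), (3, 1), (4, 3)}" and "N = {(1, 3), (2, 1), (3, 4), (4, 2)}"
  define X :: "nat \<times> nat \<Rightarrow> real"
    where "X v = (if v \<in> P then 1 else if v \<in> N then - 1 else 0)" for v
  have sub: "P \<union> N \<subseteq> queens_vertices n"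
    using assms by (auto simp: P_def N_def queens_vertices_def)
  have sum: "fibre_sum (queens_vertices n) f X c =
      (\<Sum>v\<in>P. if f v = c then 1 else 0) - (\<Sum>v\<in>N. if f v = c then 1 else 0)"
    for f :: "nat \<times> nat \<Rightarrow> 'c" and c
  proof -
    have "fibre_sum (queens_vertices n) f X c =
        (\<Sum>v\<in>queens_vertices n. if f v = c then X v else 0)"
      by (simp add: fibre_sum_eq_sum_if)
    also have "\<dots> = (\<Sum>v\<in>P \<union> N. if f v = c then X v else 0)"
      by (intro sum.mono_neutral_right[OF _ sub]) (auto simp: X_def)
    also have "\<dots> = (\<Sum>v\<in>P. if f v = c then X v else 0) + (\<Sum>v\<in>N. if f v = c then X v else 0)"
      by (intro sum.union_disjoint) (auto simp: P_def N_def)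
    also have "(\<Sum>v\<in>P. if f v = c then X v else 0) = (\<Sum>v\<in>P. if f v = c then 1 else 0)"
      by (intro sum.cong) (auto simp: X_def)
    also have "(\<Sum>v\<in>N. if f v = c then X v else 0) = (\<Sum>v\<in>N. - (if f v = c then 1 else 0))"
      by (intro sum.cong) (auto simp: X_def P_def N_def)
    finally show ?thesis
      by (simp only: sum_negf diff_conv_add_uminus)
  qed
  have "queens_vec_nonzero n X"
    unfolding queens_vec_nonzero_def using sub by (auto simp: X_def P_def)
  moreover have "line_sums_zero n X"
    \<comment> \<open>Each of the four maps is injective on \<open>P\<close> and on \<open>N\<close>
      and has the same image on both. So every line contains either no nonzero entry or exactly one
      1 and one -1.\<close>
    unfolding line_sums_zero_def sum by (simp add: P_def N_def)
  ultimately show ?thesis by blast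
qed

theorem theorem4p1:
  fixes n :: nat
  assumes "n \<ge> 4"
  shows "(eigenvalue (queens_mat n) (- 4) \<longleftrightarrow>
            (\<exists>X :: nat \<times> nat \<Rightarrow> real. queens_vec_nonzero n X \<and> queens_conditions n X))
       \<and> (\<forall>X :: nat \<times> nat \<Rightarrow> real. queens_vec_nonzero n X \<and> queens_conditions n X \<longrightarrow>
            eigenvector (queens_mat n) (coord_vec (queens_list n) X) (- 4))
       \<and> (eigenvalue (queens_mat n) (- 4) \<and>
            (\<forall>k :: real. eigenvalue (queens_mat n) k \<longrightarrow> - 4 \<le> k))"
proof -
  \<comment> \<open>Turns a statement about all library vectors into one about functions on the
    squares, to which the bound and the description of the eigenspace apply.\<close>
  have ev: "eigenvalue (queens_mat n) k \<longleftrightarrow>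
      (\<exists>X. eigenvector (queens_mat n) (coord_vec (queens_list n) X) k)" for k
    unfolding queens_mat_def by (rule eigenvalue_adjacency_mat_iff[OF distinct_queens_list])
  have "queens_conditions n X \<longleftrightarrow> line_sums_zero n X" for X
    using assms by (intro queens_conditions_iff_line_sums_zero) simp
  then show ?thesis
    using ex_line_sums_zero[OF assms] queens_eigenvector_ge[of n]
    by (auto simp: ev queens_eigenvector_minus_4_iff)
qed

end
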